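(* Let $E$ be a separable Hilbert space with norm $|\cdot|$, let $X$ be a square-integrable $E$-valued random variable, and let $A=(A_i)_{i\in I}$ be a finite Borel partition of $E$ with $p_i:=\mathbb{P}(X\in A_i)>0$ for all $i\in I$. Let $\mathrm{Proj}_{A,X}(x)=\sum_{i\in I}\mathbb{E}[X\mid X\in A_i]\,\mathbf 1_{A_i}(x)$ and $\sigma_i^2=\mathbb{E}\big[|X-\mathbb{E}[X\mid X\in A_i]|^2\,\big|\,X\in A_i\big]$, $\sigma_i\ge 0$. For a Lipschitz continuous $F$, let $[F]_{\mathrm{Lip}}=\sup_{x\ne y}\frac{|F(x)-F(y)|}{|x-y|}$ and $\sigma_{F,i}^2=\mathbb{E}\big[|F(X)-\mathbb{E}[F(X)\mid X\in A_i]|^2\,\big|\,X\in A_i\big]$, $\sigma_{F,i}\ge 0$. Let $\mathcal G=\sigma(\{X\in A_i\},\ i\in I)$. Then: 1. For every Lipschitz continuous $F:E\to E$ and every $i\in I$, $\sigma_{F,i}\le [F]_{\mathrm{Lip}}\,\sigma_i$, so that $$\sup_{[F]_{\mathrm{Lip}}\le 1}\sigma_{F,i}=\sigma_i .$$ 2. $$\sup_{[F]_{\mathrm{Lip}}\le 1}\Big(\sum_{i\in I}p_i\sigma_{F,i}^2\Big)=\sum_{i\in I}p_i\sigma_i^2=\big\|X-\mathbb{E}[X\mid\mathcal G]\big\|_2^2=\big\|X-\mathrm{Proj}_{A,X}(X)\big\|_2^2 .$$ 3. $$\sup_{[F]_{\mathrm{Lip}}\le 1}\Big(\sum_{i\in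 I}p_i\sigma_{F,i}\Big)^2=\Big(\sum_{i\in I}p_i\sigma_i\Big)^2,$$ and $$\Big(\sum_{i\in I}p_i\sigma_i\Big)^2\ge\big\|X-\mathbb{E}[X\mid\mathcal G]\big\|_1^2=\big\|X-\mathrm{Proj}_{A,X}(X)\big\|_1^2 .$$ (In items 1–3 the suprema are over Lipschitz continuous $F:E\to E$ with $[F]_{\mathrm{Lip}}\le 1$.) 4. If the suprema are instead taken over real-valued Lipschitz continuous functions $F:E\to\mathbb{R}$ with $[F]_{\mathrm{Lip}}\le 1$, the equalities hold as inequalities: $\sup_F\sigma_{F,i}\le\sigma_i$ for all $i\in I$, $\sup_F\sum_{i\in I}p_i\sigma_{F,i}^2\le\sum_{i\in I}p_i\sigma_i^2=\|X-\mathbb{E}[X\mid\mathcal G]\|_2^2=\|X-\mathrm{Proj}_{A,X}(X)\|_2^2$, and $\sup_F\big(\sum_{i\in I}p_i\sigma_{F,i}\big)^2\le\big(\sum_{i\in I}p_i\sigma_i\big)^2$.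
   Context: For $Z$ a random variable with values in a Hilbert space (or in $\mathbb{R}$) and $p\in\{1,2\}$, $\|Z\|_p=\mathbb{E}[|Z|^p]^{1/p}$. For an event $B$ of positive probability, $\mathbb{E}[Z\mid B]=\mathbb{E}[Z\mathbf 1_B]/\mathbb{P}(B)$ (Bochner expectation). *)

theory Defs
  imports "HOL-Probability.Probability"
begin

definition Lp_norm :: "'w measure \<Rightarrow> nat \<Rightarrow> ('w \<Rightarrow> 'b::real_normed_vector) \<Rightarrow> real" where
  "Lp_norm M p Z = (\<integral>\<omega>. norm (Z \<omega>) ^ p \<partial>M) powr (1 / real p)"

definition cond_mean ::
  "'w measure \<Rightarrow> ('w \<Rightarrow> 'b::{banach, second_countable_topology}) \<Rightarrow> 'w set \<Rightarrow> 'b" where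
  "cond_mean M Z B = (LINT \<omega>:B|M. Z \<omega>) /\<^sub>R measure M B"

definition cond_sd ::
  "'w measure \<Rightarrow> ('w \<Rightarrow> 'b::{banach, second_countable_topology}) \<Rightarrow> 'w set \<Rightarrow> real" where
  "cond_sd M Z B = sqrt (cond_mean M (\<lambda>\<omega>. (norm (Z \<omega> - cond_mean M Z B))\<^sup>2) B)"

text \<open>\<open>real_cond_exp\<close> covers real-valued variables only, so versions of the conditional
  expectation of a vector-valued variable are characterised here directly.\<close>

definition is_cond_exp ::
  "'w measure \<Rightarrow> 'w measure \<Rightarrow> ('w \<Rightarrow> 'b::{banach, second_countable_topology}) \<Rightarrow> ('w \<Rightarrow> 'b) \<Rightarrow> bool" where
  "is_cond_exp M G Z Y \<longleftrightarrow> Y \<in> borel_measurable G \<and> integrable M Y \<and>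
     (\<forall>B\<in>sets G. (LINT \<omega>:B|M. Y \<omega>) = (LINT \<omega>:B|M. Z \<omega>))"

definition cond_exp ::
  "'w measure \<Rightarrow> 'w measure \<Rightarrow> ('w \<Rightarrow> 'b::{banach, second_countable_topology}) \<Rightarrow> 'w \<Rightarrow> 'b" where
  "cond_exp M G Z = (SOME Y. is_cond_exp M G Z Y)"

definition lipschitz :: "('a::metric_space \<Rightarrow> 'b::metric_space) \<Rightarrow> bool" where
  "lipschitz F \<longleftrightarrow> (\<exists>L. L-lipschitz_on UNIV F)"

text \<open>The quotients are nonnegative, so inserting \<open>0\<close> does not change the supremum; it only
  fixes the value \<open>0\<close> on a one-point space, where there is no quotient. The set is bounded above
  exactly when \<open>F\<close> is Lipschitz, so \<open>lip_const F\<close> is meaningful only for such \<open>F\<close>.\<close>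

definition lip_const :: "('a::real_normed_vector \<Rightarrow> 'b::real_normed_vector) \<Rightarrow> real" where
  "lip_const F = Sup (insert 0 {norm (F x - F y) / norm (x - y) | x y. x \<noteq> y})"

definition Lip1 :: "('a::real_normed_vector \<Rightarrow> 'b::real_normed_vector) set" where
  "Lip1 = {F. lipschitz F \<and> lip_const F \<le> 1}"

definition preim :: "'w measure \<Rightarrow> ('w \<Rightarrow> 'a) \<Rightarrow> 'a set \<Rightarrow> 'w set" where
  "preim M X S = X -` S \<inter> space M"

definition Proj :: "'w measure \<Rightarrow> ('w \<Rightarrow> 'a) \<Rightarrow> 'i set \<Rightarrow> ('i \<Rightarrow> 'a set)
    \<Rightarrow> 'a::{banach, second_countable_topology} \<Rightarrow> 'a" where
  "Proj M X I A x = (\<Sum>i\<in>I. indicator (A i) x *\<^sub>R cond_mean M X (preim M X (A i)))"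

end

theory Submission
  imports Defs
begin

text \<open>
  Conditionally on an event \<open>B\<close>, the mean of \<open>Z\<close> minimises \<open>c \<mapsto> \<bbbE>[|Z - c|\<^sup>2 | B]\<close>; this is the
  parallel-axis identity \<open>cond_mean_sq_dist\<close>. To bound the deviation of \<open>F(X)\<close> one may therefore
  replace its own mean by the competitor \<open>c = F(\<bbbE>[X | B])\<close>, and then the Lipschitz estimate
  applies pointwise (\<open>cond_sd_lipschitz_le\<close>). The bound is attained at \<open>F = id\<close> when \<open>F\<close> takes its
  values in the space itself, so all three suprema are maxima there; for real-valued \<open>F\<close> the
  identity is in general not available and only the inequalities remain.

  For the quadratic and absolute errors, a \<open>\<sigma>\<close>-algebra generated by a finite partition has the
  blocks as atoms: a measurable set contains a block or misses it. Hence a measurable function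
  is constant on each block, and a conditional expectation of \<open>X\<close> must equal the block mean there.
  It thus coincides with the projection everywhere on the space, not merely almost surely
  (\<open>cond_exp_partition\<close>). Splitting the integrals along the blocks gives the quadratic identity, and
  the same splitting with \<open>\<bbbE>[|Y| | B]\<^sup>2 \<le> \<bbbE>[|Y|\<^sup>2 | B]\<close>, another instance of the parallel-axis
  identity, gives the bound for the absolute error.
\<close>

section \<open>Lipschitz constants\<close>

lemma lip_const_bdd_above:
  fixes F :: "'a::real_normed_vector \<Rightarrow> 'b::real_normed_vector"
  assumes "lipschitz F"
  shows "bdd_above (insert 0 {norm (F x - F y) / norm (x - y) | x y. x \<noteq> y})"
proof -
  obtain L where L: "L-lipschitz_on UNIV F"
    using assms by (auto simp: lipschitz_def)
  have "norm (F x - F y) / norm (x - y) \<le> L" if "x \<noteq> y" for x y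
    using lipschitz_onD[OF L, of x y] that by (simp add: dist_norm divide_simps)
  then show ?thesis
    by (auto intro!: bdd_aboveI[where M = L] lipschitz_on_nonneg[OF L])
qed

lemma lip_const_nonneg: "lipschitz F \<Longrightarrow> 0 \<le> lip_const F"
  unfolding lip_const_def by (rule cSup_upper[OF _ lip_const_bdd_above]) auto

lemma norm_diff_le_lip_const:
  assumes "lipschitz F"
  shows "norm (F x - F y) \<le> lip_const F * norm (x - y)"
proof (cases "x = y")
  case False
  have "norm (F x - F y) / norm (x - y) \<le> lip_const F"
    unfolding lip_const_def
    by (rule cSup_upper[OF _ lip_const_bdd_above[OF assms]]) (use False in auto)
  then show ?thesis
    using False by (simp add: divide_simps)
qed simp

lemma lipschitz_borel_measurable:
  assumes "lipschitz F"
  shows "F \<in> borel_measurable borel"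
  using assms
  by (auto simp: lipschitz_def intro: borel_measurable_continuous_onI lipschitz_on_continuous_on)

lemma id_in_Lip1: "(\<lambda>x. x) \<in> Lip1"
proof -
  have "lipschitz (\<lambda>x. x)"
    by (auto simp: lipschitz_def intro!: exI[of _ 1] lipschitz_onI)
  moreover have "lip_const (\<lambda>x::'a. x) \<le> 1"
    unfolding lip_const_def by (rule cSup_least) auto
  ultimately show ?thesis
    by (simp add: Lip1_def)
qed

section \<open>Conditional means and deviations given an event\<close>

lemma (in finite_measure) norm_square_integrable_imp_integrable:
  fixes Z :: "'a \<Rightarrow> 'b::{banach, second_countable_topology}"
  assumes "Z \<in> borel_measurable M" "integrable M (\<lambda>\<omega>. (norm (Z \<omega>))\<^sup>2)"
  shows "integrable M Z"
proof (rule Bochner_Integration.integrable_bound)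
  show "integrable M (\<lambda>\<omega>. 1 + (norm (Z \<omega>))\<^sup>2)"
    using assms by simp
  have "t \<le> 1 + t\<^sup>2" for t :: real
    using zero_le_power2[of "t - 1/2"] by (simp add: power2_eq_square algebra_simps)
  then show "AE \<omega> in M. norm (Z \<omega>) \<le> norm (1 + (norm (Z \<omega>))\<^sup>2)"
    by auto
qed (use assms in simp)

lemma (in finite_measure) norm_square_diff_integrable:
  fixes Z :: "'a \<Rightarrow> 'b::{real_inner, banach, second_countable_topology}"
  assumes "Z \<in> borel_measurable M" "integrable M (\<lambda>\<omega>. (norm (Z \<omega>))\<^sup>2)"
  shows "integrable M (\<lambda>\<omega>. (norm (Z \<omega> - c))\<^sup>2)"
proof -
  have "(norm (z - c))\<^sup>2 = (norm z)\<^sup>2 - 2 * (z \<bullet> c) + (norm c)\<^sup>2" for z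
    by (simp add: power2_norm_eq_inner inner_diff inner_commute)
  moreover have "integrable M (\<lambda>\<omega>. Z \<omega> \<bullet> c)"
    using norm_square_integrable_imp_integrable[OF assms] by simp
  ultimately show ?thesis
    using assms by simp
qed

lemma set_integrable_of_integrable:
  fixes f :: "'a \<Rightarrow> 'b::{banach, second_countable_topology}"
  shows "integrable M f \<Longrightarrow> B \<in> sets M \<Longrightarrow> set_integrable M B f"
  by (simp add: set_integrable_def integrable_mult_indicator del: real_scaleR_def)

lemma (in finite_measure) set_integral_constant:
  fixes c :: "'b::{banach, second_countable_topology}"
  shows "B \<in> sets M \<Longrightarrow> (LINT \<omega>:B|M. c) = measure M B *\<^sub>R c"
  by (simp add: set_integral_const emeasure_eq_measure)

lemma set_integral_eq_cond_mean:
  "measure M B \<noteq> 0 \<Longrightarrow> (LINT \<omega>:B|M. Z \<omega>) = measure M B *\<^sub>R cond_mean M Z B"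
  by (simp add: cond_mean_def)

lemma cond_mean_cong:
  "(\<And>\<omega>. \<omega> \<in> B \<Longrightarrow> Z \<omega> = Z' \<omega>) \<Longrightarrow> B \<in> sets M \<Longrightarrow> cond_mean M Z B = cond_mean M Z' B"
  unfolding cond_mean_def by (metis set_lebesgue_integral_cong)

lemma cond_mean_nonneg:
  fixes Z :: "'a \<Rightarrow> real"
  shows "(\<And>\<omega>. 0 \<le> Z \<omega>) \<Longrightarrow> 0 \<le> cond_mean M Z B"
  by (simp add: cond_mean_def set_lebesgue_integral_def)

lemma (in finite_measure) cond_mean_mono:
  fixes Z Z' :: "'a \<Rightarrow> real"
  assumes "integrable M Z" "integrable M Z'" "B \<in> sets M" "\<And>\<omega>. Z \<omega> \<le> Z' \<omega>"
  shows "cond_mean M Z B \<le> cond_mean M Z' B"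
proof -
  have "(LINT \<omega>:B|M. Z \<omega>) \<le> (LINT \<omega>:B|M. Z' \<omega>)"
    using assms by (intro set_integral_mono set_integrable_of_integrable)
  then show ?thesis
    by (simp add: cond_mean_def mult_left_mono)
qed

lemma cond_sd_nonneg: "0 \<le> cond_sd M Z B"
  by (simp add: cond_sd_def cond_mean_nonneg)

lemma cond_sd_power2:
  "(cond_sd M Z B)\<^sup>2 = cond_mean M (\<lambda>\<omega>. (norm (Z \<omega> - cond_mean M Z B))\<^sup>2) B"
  by (simp add: cond_sd_def cond_mean_nonneg)

text \<open>The cross term of the expanded square is the inner product of \<open>m - c\<close> with the integral of
  \<open>Z - m\<close> over \<open>B\<close>, which vanishes for the conditional mean \<open>m\<close>.\<close>

lemma (in finite_measure) cond_mean_sq_dist: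
  fixes Z :: "'a \<Rightarrow> 'b::{real_inner, banach, second_countable_topology}"
  assumes Z: "Z \<in> borel_measurable M" "integrable M (\<lambda>\<omega>. (norm (Z \<omega>))\<^sup>2)"
    and B: "B \<in> sets M" "measure M B > 0"
  shows "cond_mean M (\<lambda>\<omega>. (norm (Z \<omega> - c))\<^sup>2) B
    = (cond_sd M Z B)\<^sup>2 + (norm (cond_mean M Z B - c))\<^sup>2"
proof -
  define m where "m = cond_mean M Z B"
  have int: "integrable M Z"
    by (rule norm_square_integrable_imp_integrable[OF Z])
  note set_int = set_integrable_of_integrable[OF _ B(1)]
  note const = set_integral_constant[OF B(1)]
  have "(LINT \<omega>:B|M. Z \<omega> - m) = 0"
    using B by (simp add: set_integral_diff set_int int const m_def set_integral_eq_cond_mean)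
  then have cross: "(LINT \<omega>:B|M. (Z \<omega> - m) \<bullet> (m - c)) = 0"
    using set_int[of "\<lambda>\<omega>. Z \<omega> - m"] int
    unfolding set_lebesgue_integral_def set_integrable_def
    by (simp flip: inner_scaleR_left)
  have "(norm (Z \<omega> - c))\<^sup>2 = (norm (Z \<omega> - m))\<^sup>2 + (2 * ((Z \<omega> - m) \<bullet> (m - c)) + (norm (m - c))\<^sup>2)"
    for \<omega>
    by (simp add: power2_norm_eq_inner inner_diff inner_commute)
  then have "(LINT \<omega>:B|M. (norm (Z \<omega> - c))\<^sup>2)
      = (LINT \<omega>:B|M. (norm (Z \<omega> - m))\<^sup>2) + measure M B * (norm (m - c))\<^sup>2"
    by (simp add: set_integral_add set_int int norm_square_diff_integrable[OF Z] cross const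
        del: inner_diff_left inner_diff_right)
  moreover have "cond_mean M f B = (LINT \<omega>:B|M. f \<omega>) / measure M B" for f :: "'a \<Rightarrow> real"
    by (simp add: cond_mean_def divide_inverse)
  ultimately show ?thesis
    using B by (simp add: cond_sd_power2 add_divide_distrib flip: m_def)
qed

text \<open>The Lipschitz estimate compares \<open>F(X)\<close> with \<open>F(\<bbbE>[X | B])\<close>, which is a worse centre than the
  conditional mean of \<open>F(X)\<close>.\<close>

lemma (in finite_measure) cond_sd_lipschitz_le:
  fixes X :: "'a \<Rightarrow> 'b::{real_inner, banach, second_countable_topology}"
    and F :: "'b \<Rightarrow> 'c::{real_inner, banach, second_countable_topology}"
  assumes X: "X \<in> borel_measurable M" "integrable M (\<lambda>\<omega>. (norm (X \<omega>))\<^sup>2)"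
    and B: "B \<in> sets M" "measure M B > 0"
    and F: "lipschitz F"
  shows "cond_sd M (\<lambda>\<omega>. F (X \<omega>)) B \<le> lip_const F * cond_sd M X B"
proof -
  define L where "L = lip_const F"
  define m where "m = cond_mean M X B"
  have FX: "(\<lambda>\<omega>. F (X \<omega>)) \<in> borel_measurable M"
    using measurable_compose[OF X(1) lipschitz_borel_measurable[OF F]] .
  have dist: "(norm (F x - F m))\<^sup>2 \<le> L\<^sup>2 * (norm (x - m))\<^sup>2" for x
    using power_mono[OF norm_diff_le_lip_const[OF F], of x m 2]
    by (simp add: L_def power_mult_distrib)
  have int_dist: "integrable M (\<lambda>\<omega>. L\<^sup>2 * (norm (X \<omega> - m))\<^sup>2)"
    by (intro integrable_mult_right norm_square_diff_integrable[OF X])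
  \<comment> \<open>Square integrability of \<open>F(X)\<close> comes from that of \<open>F(X) - F(m)\<close>, where the Lipschitz bound
      applies; shifting by the constant \<open>F(m)\<close> is harmless for a finite measure.\<close>
  have centred: "integrable M (\<lambda>\<omega>. (norm (F (X \<omega>) - F m))\<^sup>2)"
    by (rule Bochner_Integration.integrable_bound[OF int_dist]) (use FX dist in auto)
  have sq: "integrable M (\<lambda>\<omega>. (norm (F (X \<omega>)))\<^sup>2)"
    using norm_square_diff_integrable[of "\<lambda>\<omega>. F (X \<omega>) - F m" "- F m"] FX centred by simp
  have "(cond_sd M (\<lambda>\<omega>. F (X \<omega>)) B)\<^sup>2 \<le> cond_mean M (\<lambda>\<omega>. (norm (F (X \<omega>) - F m))\<^sup>2) B"
    by (simp add: cond_mean_sq_dist[OF FX sq B])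
  also have "\<dots> \<le> cond_mean M (\<lambda>\<omega>. L\<^sup>2 * (norm (X \<omega> - m))\<^sup>2) B"
    by (rule cond_mean_mono[OF centred int_dist B(1) dist])
  also have "\<dots> = (L * cond_sd M X B)\<^sup>2"
    by (simp add: power_mult_distrib cond_sd_power2 flip: m_def)
       (simp add: cond_mean_def)
  finally show ?thesis
    unfolding L_def
    by (rule power2_le_imp_le) (simp add: cond_sd_nonneg lip_const_nonneg[OF F])
qed

lemma (in finite_measure) cond_sd_Lip1_le:
  fixes X :: "'a \<Rightarrow> 'b::{real_inner, banach, second_countable_topology}"
    and F :: "'b \<Rightarrow> 'c::{real_inner, banach, second_countable_topology}"
  assumes "X \<in> borel_measurable M" "integrable M (\<lambda>\<omega>. (norm (X \<omega>))\<^sup>2)"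
    and "B \<in> sets M" "measure M B > 0" and F: "F \<in> Lip1"
  shows "cond_sd M (\<lambda>\<omega>. F (X \<omega>)) B \<le> cond_sd M X B"
proof -
  have "lip_const F * cond_sd M X B \<le> 1 * cond_sd M X B"
    using F by (intro mult_right_mono) (auto simp: Lip1_def cond_sd_nonneg)
  then show ?thesis
    using cond_sd_lipschitz_le[OF assms(1-4), of F] F by (simp add: Lip1_def)
qed

text \<open>Dropping the variance of \<open>|X - m|\<close> around its own conditional mean leaves the
  Cauchy--Schwarz inequality between the first and second conditional moments.\<close>

lemma (in finite_measure) cond_mean_norm_diff_le_cond_sd:
  fixes X :: "'a \<Rightarrow> 'b::{real_inner, banach, second_countable_topology}"
  assumes X: "X \<in> borel_measurable M" "integrable M (\<lambda>\<omega>. (norm (X \<omega>))\<^sup>2)"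
    and B: "B \<in> sets M" "measure M B > 0"
  shows "cond_mean M (\<lambda>\<omega>. norm (X \<omega> - cond_mean M X B)) B \<le> cond_sd M X B"
proof -
  define Y where "Y = (\<lambda>\<omega>. norm (X \<omega> - cond_mean M X B))"
  have Y: "Y \<in> borel_measurable M" "integrable M (\<lambda>\<omega>. (norm (Y \<omega>))\<^sup>2)"
    using X(1) norm_square_diff_integrable[OF X] by (simp_all add: Y_def)
  have "(cond_mean M Y B)\<^sup>2 \<le> cond_mean M (\<lambda>\<omega>. (Y \<omega>)\<^sup>2) B"
    using cond_mean_sq_dist[OF Y B, of 0] by simp
  also have "\<dots> = (cond_sd M X B)\<^sup>2"
    by (simp add: cond_sd_power2 Y_def)
  finally show ?thesis
    unfolding Y_def by (rule power2_le_imp_le) (rule cond_sd_nonneg)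
qed

section \<open>Sigma-algebras generated by finite partitions\<close>

text \<open>"Contains or misses the block" is preserved by complements and countable unions and holds for
  the generators because they are disjoint: the blocks are the atoms of the generated
  \<open>\<sigma>\<close>-algebra.\<close>

lemma sigma_sets_partition_atom:
  assumes "D \<in> sigma_sets \<Omega> (B ` I)" "disjoint_family_on B I" "i \<in> I" "B i \<subseteq> \<Omega>"
  shows "B i \<subseteq> D \<or> B i \<inter> D = {}"
  using assms(1)
proof induction
  case (Basic D)
  then obtain j where "j \<in> I" "D = B j" by auto
  then show ?case
    using assms(2,3) by (cases "i = j") (auto simp: disjoint_family_on_def)
next
  case (Compl D)
  then show ?case using assms(4) by blast
next
  case (Union D)
  then show ?case by blast
qed auto

text \<open>The level set of \<open>Y\<close> through \<open>\<omega>\<close> is measurable and meets the atom \<open>B i\<close>, so it contains it.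
  The T1 axiom makes singletons, hence level sets, measurable.\<close>

lemma measurable_constant_on_block:
  fixes Y :: "'w \<Rightarrow> 'b::t1_space"
  assumes Y: "Y \<in> borel_measurable (sigma \<Omega> (B ` I))"
    and B: "disjoint_family_on B I" "\<And>i. i \<in> I \<Longrightarrow> B i \<subseteq> \<Omega>"
    and i: "i \<in> I" "\<omega> \<in> B i" "\<omega>' \<in> B i"
  shows "Y \<omega> = Y \<omega>'"
proof -
  let ?D = "Y -` {Y \<omega>} \<inter> \<Omega>"
  have Pow: "B ` I \<subseteq> Pow \<Omega>" using B(2) by blast
  have "?D \<in> sigma_sets \<Omega> (B ` I)"
    using measurable_sets[OF Y, of "{Y \<omega>}"] Pow by (simp add: sets_measure_of space_measure_of)
  from sigma_sets_partition_atom[OF this B(1) i(1) B(2)[OF i(1)]]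
  show ?thesis using i B(2)[OF i(1)] by auto
qed

locale finite_partition = prob_space M for M :: "'w measure" +
  fixes I :: "'i set" and B :: "'i \<Rightarrow> 'w set"
  assumes finite_index: "finite I"
    and block_sets: "i \<in> I \<Longrightarrow> B i \<in> sets M"
    and block_pos: "i \<in> I \<Longrightarrow> measure M (B i) > 0"
    and disjoint_blocks: "disjoint_family_on B I"
    and blocks_cover: "(\<Union>i\<in>I. B i) = space M"
begin

text \<open>This is the projection onto the block means evaluated at the random variable, written directly
  on the sample space so that it makes sense for a partition not induced by \<open>Z\<close>.\<close>

definition block_mean :: "('w \<Rightarrow> 'b::{banach, second_countable_topology}) \<Rightarrow> 'w \<Rightarrow> 'b" where
  "block_mean Z \<omega> = (\<Sum>i\<in>I. indicator (B i) \<omega> *\<^sub>R cond_mean M Z (B i))"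

lemma block_mean_on_block:
  assumes "i \<in> I" "\<omega> \<in> B i"
  shows "block_mean Z \<omega> = cond_mean M Z (B i)"
proof -
  have "block_mean Z \<omega> = (\<Sum>j\<in>I. if j = i then cond_mean M Z (B i) else 0)"
    unfolding block_mean_def
    using assms disjoint_blocks
    by (intro sum.cong) (auto simp: disjoint_family_on_def indicator_def)
  then show ?thesis
    using assms finite_index by simp
qed

lemma block_mean_measurable [measurable]: "block_mean Z \<in> borel_measurable M"
  unfolding block_mean_def using block_sets by (intro borel_measurable_sum borel_measurable_scaleR) auto

lemma set_integral_blocks:
  fixes f :: "'w \<Rightarrow> 'b::{banach, second_countable_topology}"
  assumes "integrable M f" "J \<subseteq> I"
  shows "(LINT \<omega>:(\<Union>i\<in>J. B i)|M. f \<omega>) = (\<Sum>i\<in>J. LINT \<omega>:B i|M. f \<omega>)"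
  using assms finite_index block_sets disjoint_blocks
  by (intro set_integral_finite_Union)
     (auto intro!: set_integrable_of_integrable disjoint_family_on_mono[OF _ disjoint_blocks]
       dest: finite_subset)

lemma integral_blocks:
  assumes "integrable M f"
  shows "integral\<^sup>L M f = (\<Sum>i\<in>I. measure M (B i) *\<^sub>R cond_mean M f (B i))"
proof -
  have "integral\<^sup>L M f = (LINT \<omega>:(\<Union>i\<in>I. B i)|M. f \<omega>)"
    using blocks_cover assms by (simp add: set_integral_space)
  also have "\<dots> = (\<Sum>i\<in>I. LINT \<omega>:B i|M. f \<omega>)"
    by (rule set_integral_blocks[OF assms order_refl])
  also have "\<dots> = (\<Sum>i\<in>I. measure M (B i) *\<^sub>R cond_mean M f (B i))"
    using block_pos by (intro sum.cong refl set_integral_eq_cond_mean) (auto simp: less_le)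
  finally show ?thesis .
qed

text \<open>Measurable sets are unions of blocks, so the defining integral identity has to be checked
  only on the blocks, where it is the definition of the conditional mean.\<close>

lemma block_mean_is_cond_exp:
  assumes Z: "integrable M Z"
  shows "is_cond_exp M (sigma (space M) (B ` I)) Z (block_mean Z)"
proof -
  let ?G = "sigma (space M) (B ` I)"
  have Pow: "B ` I \<subseteq> Pow (space M)"
    using block_sets sets.sets_into_space by blast
  have meas: "block_mean Z \<in> borel_measurable ?G"
    unfolding block_mean_def using Pow
    by (intro borel_measurable_sum borel_measurable_scaleR borel_measurable_indicator)
       auto
  have int: "integrable M (block_mean Z)"
    unfolding block_mean_def using block_sets
    by (intro Bochner_Integration.integrable_sum integrable_scaleR_left)
       (auto simp: integrable_indicator_iff emeasure_eq_measure)
  have block: "(LINT \<omega>:B i|M. block_mean Z \<omega>) = (LINT \<omega>:B i|M. Z \<omega>)" if "i \<in> I" for i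
  proof -
    have "(LINT \<omega>:B i|M. block_mean Z \<omega>) = (LINT \<omega>:B i|M. cond_mean M Z (B i))"
      using that by (intro set_lebesgue_integral_cong block_sets) (auto simp: block_mean_on_block)
    also have "\<dots> = (LINT \<omega>:B i|M. Z \<omega>)"
      using that block_sets[OF that] block_pos[OF that]
      by (simp add: set_integral_constant set_integral_eq_cond_mean[of M "B i" Z])
    finally show ?thesis .
  qed
  have "(LINT \<omega>:D|M. block_mean Z \<omega>) = (LINT \<omega>:D|M. Z \<omega>)" if "D \<in> sets ?G" for D
  proof -
    define J where "J = {i \<in> I. B i \<subseteq> D}"
    have D: "D \<in> sigma_sets (space M) (B ` I)"
      using that Pow by simp
    have "D = (\<Union>i\<in>J. B i)"
    proof (intro equalityI subsetI)
      fix \<omega> assume "\<omega> \<in> D"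
      with sigma_sets_into_sp[OF Pow D] obtain i where i: "i \<in> I" "\<omega> \<in> B i"
        using blocks_cover by blast
      have "B i \<subseteq> space M" using Pow i(1) by blast
      from sigma_sets_partition_atom[OF D disjoint_blocks i(1) this] have "B i \<subseteq> D"
        using i(2) \<open>\<omega> \<in> D\<close> by blast
      with i show "\<omega> \<in> (\<Union>i\<in>J. B i)" by (auto simp: J_def)
    qed (auto simp: J_def)
    moreover have "J \<subseteq> I" by (auto simp: J_def)
    ultimately show ?thesis
      using block by (auto simp: set_integral_blocks[OF int] set_integral_blocks[OF Z] intro!: sum.cong)
  qed
  with meas int show ?thesis
    by (simp add: is_cond_exp_def)
qed

text \<open>Every block has positive probability, so the constant value of a version on it is determined
  by its integral over the block; hence there is a single version, without null sets.\<close>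

lemma cond_exp_partition:
  assumes Z: "integrable M Z" and \<omega>: "\<omega> \<in> space M"
  shows "cond_exp M (sigma (space M) (B ` I)) Z \<omega> = block_mean Z \<omega>"
proof -
  let ?G = "sigma (space M) (B ` I)"
  define Y where "Y = cond_exp M ?G Z"
  have Y: "is_cond_exp M ?G Z Y"
    unfolding Y_def cond_exp_def
    by (rule someI[where P = "is_cond_exp M ?G Z"]) (rule block_mean_is_cond_exp[OF Z])
  obtain i where i: "i \<in> I" "\<omega> \<in> B i"
    using blocks_cover \<omega> by blast
  have Pow: "B ` I \<subseteq> Pow (space M)"
    using block_sets sets.sets_into_space by blast
  have "Y \<in> borel_measurable ?G"
    using Y by (simp add: is_cond_exp_def)
  then have "Y \<omega>' = Y \<omega>" if "\<omega>' \<in> B i" for \<omega>'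
    by (rule measurable_constant_on_block[OF _ disjoint_blocks _ i(1) that i(2)]) (use Pow in blast)
  then have "(LINT \<omega>':B i|M. Y \<omega>') = (LINT \<omega>':B i|M. Y \<omega>)"
    by (intro set_lebesgue_integral_cong block_sets i) simp
  also have "\<dots> = measure M (B i) *\<^sub>R Y \<omega>"
    by (rule set_integral_constant[OF block_sets[OF i(1)]])
  finally have "measure M (B i) *\<^sub>R Y \<omega> = (LINT \<omega>':B i|M. Z \<omega>')"
    using Y i Pow by (auto simp: is_cond_exp_def sets_measure_of)
  also have "\<dots> = measure M (B i) *\<^sub>R cond_mean M Z (B i)"
    using block_pos[OF i(1)] by (simp add: set_integral_eq_cond_mean)
  finally show ?thesis
    using block_pos[OF i(1)] by (simp add: Y_def block_mean_on_block[OF i])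
qed

section \<open>Quadratic and absolute errors\<close>

context
  fixes X :: "'w \<Rightarrow> 'b::{real_inner, banach, second_countable_topology}"
  assumes X: "X \<in> borel_measurable M" "integrable M (\<lambda>\<omega>. (norm (X \<omega>))\<^sup>2)"
begin

text \<open>On each block the squared error is one of the summands \<open>|X - m\<^sub>i|\<^sup>2\<close>, so their finite sum is an
  integrable dominating function.\<close>

lemma integrable_block_mean_error:
  "integrable M (\<lambda>\<omega>. (norm (X \<omega> - block_mean X \<omega>))\<^sup>2)"
  "integrable M (\<lambda>\<omega>. norm (X \<omega> - block_mean X \<omega>))"
proof -
  have meas: "(\<lambda>\<omega>. X \<omega> - block_mean X \<omega>) \<in> borel_measurable M"
    using X by measurable
  have "integrable M (\<lambda>\<omega>. \<Sum>i\<in>I. (norm (X \<omega> - cond_mean M X (B i)))\<^sup>2)"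
    by (intro Bochner_Integration.integrable_sum norm_square_diff_integrable[OF X])
  then show sq: "integrable M (\<lambda>\<omega>. (norm (X \<omega> - block_mean X \<omega>))\<^sup>2)"
  proof (rule Bochner_Integration.integrable_bound)
    show "(\<lambda>\<omega>. (norm (X \<omega> - block_mean X \<omega>))\<^sup>2) \<in> borel_measurable M"
      using meas by measurable
    show "AE \<omega> in M. norm ((norm (X \<omega> - block_mean X \<omega>))\<^sup>2)
        \<le> norm (\<Sum>i\<in>I. (norm (X \<omega> - cond_mean M X (B i)))\<^sup>2)"
    proof (rule AE_I2)
      fix \<omega> assume "\<omega> \<in> space M"
      then obtain i where i: "i \<in> I" "\<omega> \<in> B i"
        using blocks_cover by blast
      have "(norm (X \<omega> - cond_mean M X (B i)))\<^sup>2 \<le> (\<Sum>i\<in>I. (norm (X \<omega> - cond_mean M X (B i)))\<^sup>2)"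
        by (rule member_le_sum[OF i(1) _ finite_index]) simp
      then show "norm ((norm (X \<omega> - block_mean X \<omega>))\<^sup>2)
          \<le> norm (\<Sum>i\<in>I. (norm (X \<omega> - cond_mean M X (B i)))\<^sup>2)"
        by (simp add: block_mean_on_block[OF i] sum_nonneg)
    qed
  qed
  show "integrable M (\<lambda>\<omega>. norm (X \<omega> - block_mean X \<omega>))"
    using norm_square_integrable_imp_integrable[OF meas sq] by simp
qed

lemma integral_block_mean_sq_error:
  "(\<integral>\<omega>. (norm (X \<omega> - block_mean X \<omega>))\<^sup>2 \<partial>M) = (\<Sum>i\<in>I. measure M (B i) * (cond_sd M X (B i))\<^sup>2)"
  unfolding integral_blocks[OF integrable_block_mean_error(1)] real_scaleR_def cond_sd_power2
  using block_sets
  by (intro sum.cong arg_cong2[where f = "(*)"] refl cond_mean_cong) (auto simp: block_mean_on_block)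

lemma integral_block_mean_abs_error_le:
  "(\<integral>\<omega>. norm (X \<omega> - block_mean X \<omega>) \<partial>M) \<le> (\<Sum>i\<in>I. measure M (B i) * cond_sd M X (B i))"
  unfolding integral_blocks[OF integrable_block_mean_error(2)] real_scaleR_def
proof (intro sum_mono mult_left_mono)
  fix i assume i: "i \<in> I"
  have "cond_mean M (\<lambda>\<omega>. norm (X \<omega> - block_mean X \<omega>)) (B i)
      = cond_mean M (\<lambda>\<omega>. norm (X \<omega> - cond_mean M X (B i))) (B i)"
    using i block_sets by (intro cond_mean_cong) (auto simp: block_mean_on_block)
  also have "\<dots> \<le> cond_sd M X (B i)"
    using i block_sets block_pos by (intro cond_mean_norm_diff_le_cond_sd X)
  finally show "cond_mean M (\<lambda>\<omega>. norm (X \<omega> - block_mean X \<omega>)) (B i) \<le> cond_sd M X (B i)" .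
qed simp

lemma weighted_cond_sd_Lip1_le:
  fixes F :: "'b \<Rightarrow> 'c::{real_inner, banach, second_countable_topology}"
  assumes "F \<in> Lip1"
  shows "(\<Sum>i\<in>I. measure M (B i) * (cond_sd M (\<lambda>\<omega>. F (X \<omega>)) (B i))\<^sup>2)
      \<le> (\<Sum>i\<in>I. measure M (B i) * (cond_sd M X (B i))\<^sup>2)"
    and "(\<Sum>i\<in>I. measure M (B i) * cond_sd M (\<lambda>\<omega>. F (X \<omega>)) (B i))\<^sup>2
      \<le> (\<Sum>i\<in>I. measure M (B i) * cond_sd M X (B i))\<^sup>2"
proof -
  have "cond_sd M (\<lambda>\<omega>. F (X \<omega>)) (B i) \<le> cond_sd M X (B i)" if "i \<in> I" for i
    using that assms block_sets block_pos X by (intro cond_sd_Lip1_le)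
  then show "(\<Sum>i\<in>I. measure M (B i) * (cond_sd M (\<lambda>\<omega>. F (X \<omega>)) (B i))\<^sup>2)
      \<le> (\<Sum>i\<in>I. measure M (B i) * (cond_sd M X (B i))\<^sup>2)"
    and "(\<Sum>i\<in>I. measure M (B i) * cond_sd M (\<lambda>\<omega>. F (X \<omega>)) (B i))\<^sup>2
      \<le> (\<Sum>i\<in>I. measure M (B i) * cond_sd M X (B i))\<^sup>2"
    by (auto intro!: sum_mono mult_left_mono power_mono sum_nonneg simp: cond_sd_nonneg)
qed

end

end

section \<open>The Lipschitz suprema of a finite quantisation\<close>

lemma Lp_norm_cong:
  "(\<And>\<omega>. \<omega> \<in> space M \<Longrightarrow> Z \<omega> = Z' \<omega>) \<Longrightarrow> Lp_norm M q Z = Lp_norm M q Z'"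
  unfolding Lp_norm_def by (simp cong: Bochner_Integration.integral_cong)

lemma Lp_norm_1: "Lp_norm M 1 Z = (\<integral>\<omega>. norm (Z \<omega>) \<partial>M)"
  by (simp add: Lp_norm_def)

lemma Lp_norm_2_power2: "(Lp_norm M 2 Z)\<^sup>2 = (\<integral>\<omega>. (norm (Z \<omega>))\<^sup>2 \<partial>M)"
  by (simp add: Lp_norm_def powr_half_sqrt)

lemma SUP_ereal_eq_max:
  assumes "x \<in> S" "f x = c" "\<And>y. y \<in> S \<Longrightarrow> f y \<le> c"
  shows "(SUP y\<in>S. ereal (f y)) = ereal c"
  using assms by (intro antisym SUP_least SUP_upper2[of x]) auto

theorem proposition3p1:
  fixes M :: "'w measure"
    and X :: "'w \<Rightarrow> 'a::{real_inner, banach, second_countable_topology}"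
    and I :: "'i set" and A :: "'i \<Rightarrow> 'a set"
    and B :: "'i \<Rightarrow> 'w set" and p \<sigma> :: "'i \<Rightarrow> real" and G :: "'w measure"
  assumes "prob_space M"
    and "X \<in> borel_measurable M"
    and "integrable M (\<lambda>\<omega>. (norm (X \<omega>))\<^sup>2)"
    and "finite I"
    and "\<And>i. i \<in> I \<Longrightarrow> A i \<in> sets borel"
    and "disjoint_family_on A I"
    and "(\<Union>i\<in>I. A i) = UNIV"
    and B_def: "B = (\<lambda>i. preim M X (A i))"
    and p_def: "p = (\<lambda>i. measure M (B i))"
    and p_pos: "\<And>i. i \<in> I \<Longrightarrow> p i > 0"
    and \<sigma>_def: "\<sigma> = (\<lambda>i. cond_sd M X (B i))"
    and G_def: "G = sigma (space M) (B ` I)"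
  shows
    "((\<forall>(F::'a \<Rightarrow> 'a) i. lipschitz F \<longrightarrow> i \<in> I \<longrightarrow>
         cond_sd M (\<lambda>\<omega>. F (X \<omega>)) (B i) \<le> lip_const F * \<sigma> i)
      \<and> (\<forall>i\<in>I. (SUP F\<in>(Lip1 :: ('a \<Rightarrow> 'a) set). ereal (cond_sd M (\<lambda>\<omega>. F (X \<omega>)) (B i))) = ereal (\<sigma> i)))
     \<and> ((SUP F\<in>(Lip1 :: ('a \<Rightarrow> 'a) set). ereal (\<Sum>i\<in>I. p i * (cond_sd M (\<lambda>\<omega>. F (X \<omega>)) (B i))\<^sup>2))
         = ereal (\<Sum>i\<in>I. p i * (\<sigma> i)\<^sup>2)
      \<and> (\<Sum>i\<in>I. p i * (\<sigma> i)\<^sup>2) = (Lp_norm M 2 (\<lambda>\<omega>. X \<omega> - cond_exp M G X \<omega>))\<^sup>2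
      \<and> (Lp_norm M 2 (\<lambda>\<omega>. X \<omega> - cond_exp M G X \<omega>))\<^sup>2
         = (Lp_norm M 2 (\<lambda>\<omega>. X \<omega> - Proj M X I A (X \<omega>)))\<^sup>2)
     \<and> ((SUP F\<in>(Lip1 :: ('a \<Rightarrow> 'a) set). ereal ((\<Sum>i\<in>I. p i * cond_sd M (\<lambda>\<omega>. F (X \<omega>)) (B i))\<^sup>2))
         = ereal ((\<Sum>i\<in>I. p i * \<sigma> i)\<^sup>2)
      \<and> (\<Sum>i\<in>I. p i * \<sigma> i)\<^sup>2 \<ge> (Lp_norm M 1 (\<lambda>\<omega>. X \<omega> - cond_exp M G X \<omega>))\<^sup>2
      \<and> (Lp_norm M 1 (\<lambda>\<omega>. X \<omega> - cond_exp M G X \<omega>))\<^sup>2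
         = (Lp_norm M 1 (\<lambda>\<omega>. X \<omega> - Proj M X I A (X \<omega>)))\<^sup>2)
     \<and> ((\<forall>i\<in>I. (SUP F\<in>(Lip1 :: ('a \<Rightarrow> real) set). ereal (cond_sd M (\<lambda>\<omega>. F (X \<omega>)) (B i))) \<le> ereal (\<sigma> i))
      \<and> (SUP F\<in>(Lip1 :: ('a \<Rightarrow> real) set). ereal (\<Sum>i\<in>I. p i * (cond_sd M (\<lambda>\<omega>. F (X \<omega>)) (B i))\<^sup>2))
         \<le> ereal (\<Sum>i\<in>I. p i * (\<sigma> i)\<^sup>2)
      \<and> (\<Sum>i\<in>I. p i * (\<sigma> i)\<^sup>2) = (Lp_norm M 2 (\<lambda>\<omega>. X \<omega> - cond_exp M G X \<omega>))\<^sup>2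
      \<and> (Lp_norm M 2 (\<lambda>\<omega>. X \<omega> - cond_exp M G X \<omega>))\<^sup>2
         = (Lp_norm M 2 (\<lambda>\<omega>. X \<omega> - Proj M X I A (X \<omega>)))\<^sup>2
      \<and> (SUP F\<in>(Lip1 :: ('a \<Rightarrow> real) set). ereal ((\<Sum>i\<in>I. p i * cond_sd M (\<lambda>\<omega>. F (X \<omega>)) (B i))\<^sup>2))
         \<le> ereal ((\<Sum>i\<in>I. p i * \<sigma> i)\<^sup>2))"
proof -
  interpret prob_space M by fact
  note X = \<open>X \<in> borel_measurable M\<close> \<open>integrable M (\<lambda>\<omega>. (norm (X \<omega>))\<^sup>2)\<close>
  have B_sets: "B i \<in> sets M" if "i \<in> I" for i
    using measurable_sets[OF X(1)] assms(5)[OF that] by (simp add: B_def preim_def)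
  interpret finite_partition M I B
  proof
    show "measure M (B i) > 0" if "i \<in> I" for i
      using p_pos[OF that] by (simp add: p_def)
    show "disjoint_family_on B I"
      using \<open>disjoint_family_on A I\<close> by (auto simp: disjoint_family_on_def B_def preim_def)
    show "(\<Union>i\<in>I. B i) = space M"
      unfolding B_def preim_def using \<open>(\<Union>i\<in>I. A i) = UNIV\<close> by blast
  qed (use \<open>finite I\<close> B_sets in auto)
  have block_le: "cond_sd M (\<lambda>\<omega>. F (X \<omega>)) (B i) \<le> \<sigma> i" if "F \<in> Lip1" "i \<in> I"
    for F :: "'a \<Rightarrow> 'c::{real_inner, banach, second_countable_topology}" and i
    unfolding \<sigma>_def using that block_sets block_pos X by (intro cond_sd_Lip1_le)
  have proj: "Proj M X I A (X \<omega>) = block_mean X \<omega>" if "\<omega> \<in> space M" for \<omega>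
    unfolding Proj_def block_mean_def
    by (intro sum.cong) (use that in \<open>auto simp: B_def preim_def indicator_def\<close>)
  have ce: "cond_exp M G X \<omega> = block_mean X \<omega>" if "\<omega> \<in> space M" for \<omega>
    unfolding G_def by (rule cond_exp_partition[OF norm_square_integrable_imp_integrable[OF X] that])
  have err_ce: "Lp_norm M q (\<lambda>\<omega>. X \<omega> - cond_exp M G X \<omega>)
      = Lp_norm M q (\<lambda>\<omega>. X \<omega> - block_mean X \<omega>)" for q
    by (rule Lp_norm_cong) (simp add: ce)
  have err_proj: "Lp_norm M q (\<lambda>\<omega>. X \<omega> - Proj M X I A (X \<omega>))
      = Lp_norm M q (\<lambda>\<omega>. X \<omega> - block_mean X \<omega>)" for q
    by (rule Lp_norm_cong) (simp add: proj)
  have L2: "(\<Sum>i\<in>I. p i * (\<sigma> i)\<^sup>2) = (Lp_norm M 2 (\<lambda>\<omega>. X \<omega> - block_mean X \<omega>))\<^sup>2"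
    by (simp add: Lp_norm_2_power2 integral_block_mean_sq_error[OF X] p_def \<sigma>_def)
  have L1: "(Lp_norm M 1 (\<lambda>\<omega>. X \<omega> - block_mean X \<omega>))\<^sup>2 \<le> (\<Sum>i\<in>I. p i * \<sigma> i)\<^sup>2"
    unfolding Lp_norm_1 p_def \<sigma>_def by (intro power_mono integral_block_mean_abs_error_le[OF X]) simp
  have lip_le: "cond_sd M (\<lambda>\<omega>. F (X \<omega>)) (B i) \<le> lip_const F * \<sigma> i"
    if "lipschitz F" "i \<in> I" for F :: "'a \<Rightarrow> 'a" and i
    unfolding \<sigma>_def using that block_sets block_pos X by (intro cond_sd_lipschitz_le)
  have sup_sd: "(SUP F\<in>(Lip1 :: ('a \<Rightarrow> 'a) set). ereal (cond_sd M (\<lambda>\<omega>. F (X \<omega>)) (B i)))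
      = ereal (\<sigma> i)" if "i \<in> I" for i
    by (rule SUP_ereal_eq_max[OF id_in_Lip1]) (use that block_le in \<open>auto simp: \<sigma>_def\<close>)
  have sup_sq: "(SUP F\<in>(Lip1 :: ('a \<Rightarrow> 'a) set).
        ereal (\<Sum>i\<in>I. p i * (cond_sd M (\<lambda>\<omega>. F (X \<omega>)) (B i))\<^sup>2))
      = ereal (\<Sum>i\<in>I. p i * (\<sigma> i)\<^sup>2)"
    unfolding p_def \<sigma>_def
    by (rule SUP_ereal_eq_max[OF id_in_Lip1 refl]) (rule weighted_cond_sd_Lip1_le(1)[OF X])
  have sup_abs: "(SUP F\<in>(Lip1 :: ('a \<Rightarrow> 'a) set).
        ereal ((\<Sum>i\<in>I. p i * cond_sd M (\<lambda>\<omega>. F (X \<omega>)) (B i))\<^sup>2))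
      = ereal ((\<Sum>i\<in>I. p i * \<sigma> i)\<^sup>2)"
    unfolding p_def \<sigma>_def
    by (rule SUP_ereal_eq_max[OF id_in_Lip1 refl]) (rule weighted_cond_sd_Lip1_le(2)[OF X])
  have sup_sd_real: "(SUP F\<in>(Lip1 :: ('a \<Rightarrow> real) set). ereal (cond_sd M (\<lambda>\<omega>. F (X \<omega>)) (B i)))
      \<le> ereal (\<sigma> i)" if "i \<in> I" for i
    using that by (intro SUP_least) (simp add: block_le)
  have sup_sq_real: "(SUP F\<in>(Lip1 :: ('a \<Rightarrow> real) set).
        ereal (\<Sum>i\<in>I. p i * (cond_sd M (\<lambda>\<omega>. F (X \<omega>)) (B i))\<^sup>2))
      \<le> ereal (\<Sum>i\<in>I. p i * (\<sigma> i)\<^sup>2)"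
    unfolding p_def \<sigma>_def
    by (intro SUP_least) (simp add: weighted_cond_sd_Lip1_le(1)[OF X])
  have sup_abs_real: "(SUP F\<in>(Lip1 :: ('a \<Rightarrow> real) set).
        ereal ((\<Sum>i\<in>I. p i * cond_sd M (\<lambda>\<omega>. F (X \<omega>)) (B i))\<^sup>2))
      \<le> ereal ((\<Sum>i\<in>I. p i * \<sigma> i)\<^sup>2)"
    unfolding p_def \<sigma>_def
    by (intro SUP_least) (simp add: weighted_cond_sd_Lip1_le(2)[OF X])
  show ?thesis
    unfolding err_ce err_proj L2[symmetric]
    by (intro conjI allI ballI impI refl L1 lip_le sup_sd sup_sq sup_abs
        sup_sd_real sup_sq_real sup_abs_real)
qed

end
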